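(* Let $\mathbf{X}\in\mathbb{R}^{n\times p}$ have columns $\mathbf{X}_1,\dots,\mathbf{X}_p$, let $\mathbf{y}\in\mathbb{R}^n$, and let $S\subsetneq\{1,\dots,p\}$ be such that $\mathbf{X}_{S\cup\{j\}}$ has full column rank for every $j\in S^c$. Let $\mathbf{r}=\mathbf{y}-\mathbf{X}_S(\mathbf{X}_S^T\mathbf{X}_S)^{-1}\mathbf{X}_S^T\mathbf{y}$ be the least-squares residual on $S$, and let $$j^*\in\operatorname*{argmax}_{j\in S^c}\ \frac{\left(\mathbf{r}^T\mathbf{X}_j\right)^2}{\mathbf{X}_j^T\left(\mathbf{I}-\mathbf{X}_S(\mathbf{X}_S^T\mathbf{X}_S)^{-1}\mathbf{X}_S^T\right)\mathbf{X}_j}.$$ Then $$f(S\cup\{j^*\})\le f(S\cup\{j\})\qquad\text{for all } j\in S^c .$$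
   Context: For an index set $T\subset\{1,\dots,p\}$, $\mathbf{X}_T$ is the submatrix of $\mathbf{X}$ with columns indexed by $T$, $T^c$ is the complement of $T$ in $\{1,\dots,p\}$, and $$f(T)=\inf\{\|\mathbf{y}-\mathbf{X}\boldsymbol{\beta}\|_2^2:\ \boldsymbol{\beta}\in\mathbb{R}^p,\ \operatorname{supp}(\boldsymbol{\beta})=T\},$$ where $\operatorname{supp}(\boldsymbol{\beta})$ is the set of indices of nonzero entries of $\boldsymbol{\beta}$. If $S$ is empty, $\mathbf{X}_S(\mathbf{X}_S^T\mathbf{X}_S)^{-1}\mathbf{X}_S^T$ is the zero matrix. *)

theory Defs
  imports
    Complex_Main
    "Jordan_Normal_Form.DL_Rank"
    "Jordan_Normal_Form.DL_Submatrix"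
    "Jordan_Normal_Form.Gauss_Jordan_Elimination"
begin

text \<open>Vectors and matrices are those of \<open>Jordan_Normal_Form\<close>, so the indices are
  \<open>0, \<dots>, p - 1\<close> rather than \<open>1, \<dots>, p\<close>.\<close>

abbreviation col_submatrix :: "'a mat \<Rightarrow> nat set \<Rightarrow> 'a mat" where
  "col_submatrix X T \<equiv> submatrix X UNIV T"

definition full_column_rank :: "real mat \<Rightarrow> bool" where
  "full_column_rank A \<longleftrightarrow> vec_space.rank (dim_row A) A = dim_col A"

definition sq_l2_norm :: "real vec \<Rightarrow> real" where
  "sq_l2_norm v = (\<Sum>i<dim_vec v. (v $ i)\<^sup>2)"

definition vec_support :: "real vec \<Rightarrow> nat set" where
  "vec_support \<beta> = {i. i < dim_vec \<beta> \<and> \<beta> $ i \<noteq> 0}"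

text \<open>The support is required to be exactly \<open>T\<close>, so the infimum need not be attained.
  For \<open>T \<subseteq> {..<dim_col X}\<close> the set is nonempty and bounded below by \<open>0\<close>.\<close>

definition support_loss :: "real mat \<Rightarrow> real vec \<Rightarrow> nat set \<Rightarrow> real" where
  "support_loss X y T =
     Inf {sq_l2_norm (y - X *\<^sub>v \<beta>) | \<beta>. \<beta> \<in> carrier_vec (dim_col X) \<and> vec_support \<beta> = T}"

text \<open>\<open>mat_inverse\<close> returns \<open>Some\<close> of the inverse whenever the Gram matrix is invertible, i.e.
  whenever the columns indexed by \<open>S\<close> are linearly independent.  For \<open>S = {}\<close> the Gram matrix is
  the (invertible) 0-by-0 matrix and the product below is the zero matrix.\<close>

definition proj_mat :: "real mat \<Rightarrow> nat set \<Rightarrow> real mat" where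
  "proj_mat X S =
     (let A = col_submatrix X S
      in A * the (mat_inverse (transpose_mat A * A)) * transpose_mat A)"

end

theory Submission
  imports Defs
begin

text \<open>
  Write \<open>P\<close> for the orthogonal projection onto the span of the columns in \<open>S\<close>, \<open>x\<close> for the column
  \<open>X\<^sub>j\<close>, and \<open>q = x - P x\<close> for the part of it that is new.  A combination of the columns in
  \<open>S \<union> {j}\<close> can be written \<open>P y + t q + w\<close> with \<open>w\<close> in the span of \<open>S\<close>.  Since \<open>r = y - P y\<close> and
  \<open>q\<close> are orthogonal to that span, Pythagoras gives the loss
  \<open>\<parallel>r\<parallel>\<^sup>2 - 2 t (r \<bullet> q) + t\<^sup>2 (q \<bullet> q) + \<parallel>w\<parallel>\<^sup>2\<close>.  Minimizing over \<open>t\<close> and \<open>w\<close> separately leaves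
  \<open>\<parallel>r\<parallel>\<^sup>2 - (r \<bullet> q)\<^sup>2 / (q \<bullet> q)\<close>; here \<open>r \<bullet> q = r \<bullet> x\<close> and \<open>q \<bullet> q = x \<bullet> (I - P) x\<close>, so the subtracted
  quotient is exactly the score that \<open>j\<^sup>*\<close> maximizes (\<open>support_loss_add_column\<close>).

  This computes the minimum over supports contained in \<open>S \<union> {j}\<close>, whereas \<open>support_loss\<close> asks for
  the support to be equal to it.  The infimum is the same, because a minimizer becomes a
  vector of full support after an arbitrarily small perturbation (\<open>support_loss_eq_minimum\<close>).

  The rank hypothesis makes the Gram matrix of the columns in \<open>S\<close> invertible, which is what
  turns \<open>proj_mat\<close> into the orthogonal projection (\<open>proj_mat_properties\<close>).
\<close>

section \<open>Squared norms\<close>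

lemma sq_l2_norm_eq_scalar_prod: "sq_l2_norm v = v \<bullet> v"
  by (simp add: sq_l2_norm_def scalar_prod_def power2_eq_square atLeast0LessThan)

lemma sq_l2_norm_nonneg: "0 \<le> sq_l2_norm v"
  by (simp add: sq_l2_norm_def sum_nonneg)

lemma sq_l2_norm_eq_0_imp_zero:
  assumes "v \<in> carrier_vec n" "sq_l2_norm v = 0"
  shows "v = 0\<^sub>v n"
proof (rule eq_vecI)
  fix i assume "i < dim_vec (0\<^sub>v n :: real vec)"
  with assms show "v $ i = 0\<^sub>v n $ i"
    by (auto simp: sq_l2_norm_def sum_nonneg_eq_0_iff)
qed (use assms in auto)

section \<open>Full column rank and column submatrices\<close>

text \<open>The rank is the dimension of the span of the set of columns, so a repeated column
  would already make it too small.  Hence the columns are distinct, and then a nontrivial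
  kernel vector would be a linear dependence among them.\<close>

lemma full_column_rank_kernel_trivial:
  assumes A: "A \<in> carrier_mat n k" and full: "full_column_rank A"
    and v: "v \<in> carrier_vec k" and Av: "A *\<^sub>v v = 0\<^sub>v n"
  shows "v = 0\<^sub>v k"
proof (rule ccontr)
  assume nz: "v \<noteq> 0\<^sub>v k"
  interpret vec_space "TYPE(real)" n .
  have rk: "rank A = k" using A full by (auto simp: full_column_rank_def)
  have "distinct (cols A)"
  proof -
    obtain B where B: "maximal B (\<lambda>T. T \<subseteq> set (cols A) \<and> lin_indpt T)"
      using maximal_exists[of "\<lambda>T. T \<subseteq> set (cols A) \<and> lin_indpt T" "card (set (cols A))" "{}"]
      by (meson List.finite_set card_mono empty_iff empty_subsetI finite_lin_indpt2
          rev_finite_subset)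
    have "k \<le> card (set (cols A))"
      using rank_card_indpt[OF A B] rk B by (simp add: card_mono maximal_def)
    moreover have "card (set (cols A)) \<le> k"
      using card_length[of "cols A"] A by simp
    ultimately show ?thesis
      using A by (intro card_distinct) simp
  qed
  with full_rank_lin_indpt[OF A rk] lin_depI[OF A v nz Av] show False by blast
qed

lemma col_submatrix_carrier:
  assumes "X \<in> carrier_mat n p" "T \<subseteq> {..<p}"
  shows "col_submatrix X T \<in> carrier_mat n (card T)"
proof -
  have "{j. j < p \<and> j \<in> T} = T" using assms by auto
  with assms show ?thesis by (intro carrier_matI) (auto simp: dim_submatrix)
qed

text \<open>\<open>pick T\<close> is the increasing enumeration of \<open>T\<close> by which \<open>submatrix\<close> numbers its columns;
  through it, sums over columns of the submatrix become sums over \<open>T\<close>.\<close>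

lemma bij_betw_pick:
  assumes "finite T"
  shows "bij_betw (pick T) {..<card T} T"
proof -
  have "inj_on (pick T) {..<card T}"
    by (rule inj_onI) (metis card_pick_le lessThan_iff)
  moreover have "pick T ` {..<card T} \<subseteq> T"
    by (auto intro: pick_in_set_le)
  ultimately show ?thesis
    using assms by (simp add: bij_betw_def card_image card_subset_eq)
qed

text \<open>Together with \<open>extend_by_zero\<close> this translates between coefficient vectors of a column
  submatrix and vectors over all columns that are supported in \<open>T\<close>.  In the second form
  different index sets can be compared, since no renumbering is involved.\<close>

lemma col_submatrix_mult_vec:
  assumes X: "X \<in> carrier_mat n p" and T: "T \<subseteq> {..<p}"
    and \<beta>: "\<beta> \<in> carrier_vec p" "vec_support \<beta> \<subseteq> T"
  shows "col_submatrix X T *\<^sub>v vec (card T) (\<lambda>k. \<beta> $ pick T k) = X *\<^sub>v \<beta>"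
proof (rule eq_vecI)
  have eqT: "{j. j < p \<and> j \<in> T} = T" using T by auto
  have fin: "finite T" using T finite_subset by blast
  fix i assume "i < dim_vec (X *\<^sub>v \<beta>)"
  hence i: "i < n" using X by simp
  have "(col_submatrix X T *\<^sub>v vec (card T) (\<lambda>k. \<beta> $ pick T k)) $ i
      = (\<Sum>k<card T. X $$ (i, pick T k) * \<beta> $ pick T k)"
    using i X eqT col_submatrix_carrier[OF X T]
    by (auto simp: scalar_prod_def atLeast0LessThan submatrix_index pick_UNIV intro!: sum.cong)
  also have "\<dots> = (\<Sum>j\<in>T. X $$ (i, j) * \<beta> $ j)"
    by (rule sum.reindex_bij_betw[OF bij_betw_pick[OF fin]])
  also have "\<dots> = (\<Sum>j<p. X $$ (i, j) * \<beta> $ j)"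
    using T \<beta> by (intro sum.mono_neutral_left) (auto simp: vec_support_def)
  also have "\<dots> = (X *\<^sub>v \<beta>) $ i"
    using i X \<beta> by (auto simp: scalar_prod_def atLeast0LessThan intro!: sum.cong)
  finally show "(col_submatrix X T *\<^sub>v vec (card T) (\<lambda>k. \<beta> $ pick T k)) $ i = (X *\<^sub>v \<beta>) $ i" .
qed (use X col_submatrix_carrier[OF X T] in auto)

lemma extend_by_zero:
  fixes v :: "real vec"
  assumes T: "T \<subseteq> {..<p}" and v: "v \<in> carrier_vec (card T)"
  obtains \<beta> where "\<beta> \<in> carrier_vec p" "vec_support \<beta> \<subseteq> T"
    "v = vec (card T) (\<lambda>k. \<beta> $ pick T k)"
proof
  define \<beta> where "\<beta> = vec p (\<lambda>i. if i \<in> T then v $ card {a \<in> T. a < i} else 0)"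
  show "\<beta> \<in> carrier_vec p" "vec_support \<beta> \<subseteq> T"
    by (auto simp: \<beta>_def vec_support_def split: if_splits)
  show "v = vec (card T) (\<lambda>k. \<beta> $ pick T k)"
  proof (rule eq_vecI)
    fix k assume "k < dim_vec (vec (card T) (\<lambda>k. \<beta> $ pick T k))"
    hence k: "k < card T" by simp
    have "pick T k \<in> T" using pick_in_set_le[OF k] .
    moreover from this have "pick T k < p" using T by auto
    ultimately show "v $ k = vec (card T) (\<lambda>k. \<beta> $ pick T k) $ k"
      using k by (simp add: \<beta>_def card_pick_le)
  qed (use v in auto)
qed

text \<open>A kernel vector for the columns in \<open>S\<close>, padded with zeros, is one for the columns in \<open>T\<close>.\<close>

lemma full_column_rank_subset_kernel_trivial:
  assumes X: "X \<in> carrier_mat n p" and T: "T \<subseteq> {..<p}" and ST: "S \<subseteq> T"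
    and full: "full_column_rank (col_submatrix X T)"
    and v: "v \<in> carrier_vec (card S)" and Av: "col_submatrix X S *\<^sub>v v = 0\<^sub>v n"
  shows "v = 0\<^sub>v (card S)"
proof -
  have S: "S \<subseteq> {..<p}" using ST T by auto
  have fin: "finite T" using T finite_subset by blast
  obtain \<beta> where \<beta>: "\<beta> \<in> carrier_vec p" "vec_support \<beta> \<subseteq> S"
    and v_eq: "v = vec (card S) (\<lambda>k. \<beta> $ pick S k)"
    using extend_by_zero[OF S v] .
  have "X *\<^sub>v \<beta> = 0\<^sub>v n"
    using col_submatrix_mult_vec[OF X S \<beta>] Av v_eq by simp
  hence "col_submatrix X T *\<^sub>v vec (card T) (\<lambda>k. \<beta> $ pick T k) = 0\<^sub>v n"
    using col_submatrix_mult_vec[OF X T \<beta>(1)] \<beta>(2) ST by auto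
  hence zero: "vec (card T) (\<lambda>k. \<beta> $ pick T k) = 0\<^sub>v (card T)"
    by (intro full_column_rank_kernel_trivial[OF col_submatrix_carrier[OF X T] full]) auto
  have "\<beta> $ j = 0" if j: "j \<in> T" for j
  proof -
    obtain k where k: "k < card T" "j = pick T k"
      using bij_betw_imp_surj_on[OF bij_betw_pick[OF fin]] j by (metis imageE lessThan_iff)
    with arg_cong[OF zero, of "\<lambda>u. u $ k"] show ?thesis by simp
  qed
  thus ?thesis
    using ST by (auto simp: v_eq intro!: eq_vecI dest!: pick_in_set_le)
qed

section \<open>The orthogonal projection onto the selected columns\<close>

text \<open>\<open>A\<^sup>T A v = 0\<close> implies \<open>\<parallel>A v\<parallel>\<^sup>2 = v \<bullet> A\<^sup>T A v = 0\<close>, so the Gram matrix inherits a trivial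
  kernel from \<open>A\<close>.\<close>

lemma gram_mat_inverse:
  fixes A :: "real mat"
  assumes A: "A \<in> carrier_mat n k"
    and ker: "\<And>v. v \<in> carrier_vec k \<Longrightarrow> A *\<^sub>v v = 0\<^sub>v n \<Longrightarrow> v = 0\<^sub>v k"
  obtains B where "mat_inverse (transpose_mat A * A) = Some B" "B \<in> carrier_mat k k"
    "transpose_mat A * A * B = 1\<^sub>m k"
proof -
  let ?G = "transpose_mat A * A"
  have G: "?G \<in> carrier_mat k k" using A by auto
  have "v = 0\<^sub>v k" if v: "v \<in> carrier_vec k" and Gv: "?G *\<^sub>v v = 0\<^sub>v k" for v
  proof -
    have "sq_l2_norm (A *\<^sub>v v) = (transpose_mat A *\<^sub>v (A *\<^sub>v v)) \<bullet> v"
      using A v transpose_vec_mult_scalar[OF A v, of "A *\<^sub>v v"]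
      by (simp add: sq_l2_norm_eq_scalar_prod)
    also have "\<dots> = (?G *\<^sub>v v) \<bullet> v"
      using A v by (subst assoc_mult_mat_vec[of _ k n _ k]) auto
    also have "\<dots> = 0" using Gv v by simp
    finally have "A *\<^sub>v v = 0\<^sub>v n"
      using A v by (intro sq_l2_norm_eq_0_imp_zero) auto
    with ker v show ?thesis by blast
  qed
  hence "det ?G \<noteq> 0" using det_0_iff_vec_prod_zero[OF G] by blast
  hence "?G \<in> Units (ring_mat TYPE(real) k ())" by (rule det_non_zero_imp_unit[OF G])
  then obtain B where "mat_inverse ?G = Some B"
    using mat_inverse(1)[OF G, where b = "()"] by (cases "mat_inverse ?G") auto
  with mat_inverse(2)[OF G this] that show thesis by blast
qed

text \<open>The last two conclusions characterize \<open>proj_mat\<close> as the orthogonal projection onto the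
  span of the columns in \<open>S\<close>.  Orthogonality is the normal equation
  \<open>A\<^sup>T (A (A\<^sup>T A)\<^sup>-\<^sup>1 A\<^sup>T v) = A\<^sup>T v\<close>.\<close>

lemma proj_mat_properties:
  assumes X: "X \<in> carrier_mat n p" and S: "S \<subseteq> {..<p}"
    and ker: "\<And>v. v \<in> carrier_vec (card S) \<Longrightarrow> col_submatrix X S *\<^sub>v v = 0\<^sub>v n
               \<Longrightarrow> v = 0\<^sub>v (card S)"
  shows proj_mat_carrier: "proj_mat X S \<in> carrier_mat n n"
    and proj_mat_in_column_span: "v \<in> carrier_vec n \<Longrightarrow>
      \<exists>\<beta> \<in> carrier_vec p. vec_support \<beta> \<subseteq> S \<and> proj_mat X S *\<^sub>v v = X *\<^sub>v \<beta>"
    and proj_mat_residual_orthogonal: "v \<in> carrier_vec n \<Longrightarrow> \<beta> \<in> carrier_vec p \<Longrightarrow>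
      vec_support \<beta> \<subseteq> S \<Longrightarrow> (v - proj_mat X S *\<^sub>v v) \<bullet> (X *\<^sub>v \<beta>) = 0"
proof -
  define A where "A = col_submatrix X S"
  define k where "k = card S"
  have A: "A \<in> carrier_mat n k"
    unfolding A_def k_def by (rule col_submatrix_carrier[OF X S])
  have At: "transpose_mat A \<in> carrier_mat k n" using A by simp
  have kerA: "\<And>v. v \<in> carrier_vec k \<Longrightarrow> A *\<^sub>v v = 0\<^sub>v n \<Longrightarrow> v = 0\<^sub>v k"
    unfolding A_def k_def by (rule ker)
  obtain B where inv: "mat_inverse (transpose_mat A * A) = Some B"
    and B: "B \<in> carrier_mat k k" and GB: "transpose_mat A * A * B = 1\<^sub>m k"
    using gram_mat_inverse[OF A kerA] by blast
  have P: "proj_mat X S = A * B * transpose_mat A"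
    using inv by (simp add: proj_mat_def A_def Let_def)
  show "proj_mat X S \<in> carrier_mat n n" using A B by (simp add: P)
  {
    fix v :: "real vec" assume v: "v \<in> carrier_vec n"
    define w where "w = B *\<^sub>v (transpose_mat A *\<^sub>v v)"
    have w: "w \<in> carrier_vec k" using B At v by (simp add: w_def)
    have Pv: "proj_mat X S *\<^sub>v v = A *\<^sub>v w"
    proof -
      have "proj_mat X S *\<^sub>v v = (A * B) *\<^sub>v (transpose_mat A *\<^sub>v v)"
        unfolding P by (rule assoc_mult_mat_vec[OF mult_carrier_mat[OF A B] At v])
      also have "\<dots> = A *\<^sub>v w"
        unfolding w_def by (rule assoc_mult_mat_vec[OF A B]) (use At v in simp)
      finally show ?thesis .
    qed
    obtain \<beta> where "\<beta> \<in> carrier_vec p" "vec_support \<beta> \<subseteq> S"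
      "w = vec (card S) (\<lambda>k. \<beta> $ pick S k)"
      using extend_by_zero[OF S w[unfolded k_def]] .
    with col_submatrix_mult_vec[OF X S] Pv
    show "\<exists>\<beta> \<in> carrier_vec p. vec_support \<beta> \<subseteq> S \<and> proj_mat X S *\<^sub>v v = X *\<^sub>v \<beta>"
      unfolding A_def by auto
    fix \<beta> :: "real vec" assume \<beta>: "\<beta> \<in> carrier_vec p" "vec_support \<beta> \<subseteq> S"
    define u where "u = vec k (\<lambda>k. \<beta> $ pick S k)"
    have u: "u \<in> carrier_vec k" by (simp add: u_def)
    have Xu: "X *\<^sub>v \<beta> = A *\<^sub>v u"
      using col_submatrix_mult_vec[OF X S \<beta>] by (simp add: A_def u_def k_def)
    have "transpose_mat A *\<^sub>v (A *\<^sub>v w) = transpose_mat A * A *\<^sub>v w"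
      by (rule assoc_mult_mat_vec[OF At A w, symmetric])
    also have "\<dots> = transpose_mat A * A * B *\<^sub>v (transpose_mat A *\<^sub>v v)"
      unfolding w_def
      by (rule assoc_mult_mat_vec[OF mult_carrier_mat[OF At A] B, symmetric]) (use At v in simp)
    also have "\<dots> = transpose_mat A *\<^sub>v v" using GB At v by simp
    finally have normal: "transpose_mat A *\<^sub>v (A *\<^sub>v w) = transpose_mat A *\<^sub>v v" .
    have "(v - A *\<^sub>v w) \<bullet> (A *\<^sub>v u) = v \<bullet> (A *\<^sub>v u) - (A *\<^sub>v w) \<bullet> (A *\<^sub>v u)"
      using A u w v by (intro minus_scalar_prod_distrib) auto
    also have "\<dots> = (transpose_mat A *\<^sub>v v) \<bullet> u - (transpose_mat A *\<^sub>v (A *\<^sub>v w)) \<bullet> u"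
      using transpose_vec_mult_scalar[OF A u] A w v by simp
    also have "\<dots> = 0" by (simp add: normal)
    finally show "(v - proj_mat X S *\<^sub>v v) \<bullet> (X *\<^sub>v \<beta>) = 0"
      by (simp add: Pv Xu)
  }
qed

section \<open>The support loss as a minimum\<close>

text \<open>Adding \<open>t\<close> to every coordinate of \<open>\<beta>\<^sub>0\<close> in \<open>T\<close> gives support exactly \<open>T\<close> for all
  \<open>t\<close> close to but different from \<open>0\<close>, and the loss is continuous in \<open>t\<close>.  So vectors with support
  exactly \<open>T\<close> come arbitrarily close to the minimum over supports contained in \<open>T\<close>.\<close>

lemma support_loss_eq_minimum:
  assumes X: "X \<in> carrier_mat n p" and y: "y \<in> carrier_vec n" and T: "T \<subseteq> {..<p}"
    and \<beta>\<^sub>0: "\<beta>\<^sub>0 \<in> carrier_vec p" "vec_support \<beta>\<^sub>0 \<subseteq> T"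
    and min: "\<And>\<beta>. \<beta> \<in> carrier_vec p \<Longrightarrow> vec_support \<beta> \<subseteq> T \<Longrightarrow>
                sq_l2_norm (y - X *\<^sub>v \<beta>\<^sub>0) \<le> sq_l2_norm (y - X *\<^sub>v \<beta>)"
  shows "support_loss X y T = sq_l2_norm (y - X *\<^sub>v \<beta>\<^sub>0)"
proof -
  define L where "L = {sq_l2_norm (y - X *\<^sub>v \<beta>) | \<beta>. \<beta> \<in> carrier_vec p \<and> vec_support \<beta> = T}"
  have loss: "support_loss X y T = Inf L"
    using X by (auto simp: support_loss_def L_def)
  have below: "sq_l2_norm (y - X *\<^sub>v \<beta>\<^sub>0) \<le> z" if "z \<in> L" for z
    using that min by (auto simp: L_def)
  have fin: "finite T" using T finite_subset by blast
  define \<beta> where "\<beta> t = vec p (\<lambda>i. \<beta>\<^sub>0 $ i + (if i \<in> T then t else 0))" for t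
  define g where "g t = sq_l2_norm (y - X *\<^sub>v \<beta> t)" for t
  have g_eq: "g t = (\<Sum>i<n. (y $ i - (\<Sum>k<p. X $$ (i,k) * (\<beta>\<^sub>0 $ k + (if k \<in> T then t else 0))))\<^sup>2)"
    for t
    using X y by (auto simp: g_def sq_l2_norm_def \<beta>_def scalar_prod_def atLeast0LessThan
        intro!: sum.cong arg_cong[where f = "\<lambda>x. (_ - x)\<^sup>2"])
  have "\<beta> 0 = \<beta>\<^sub>0" using \<beta>\<^sub>0 by (auto simp: \<beta>_def)
  hence g0: "g 0 = sq_l2_norm (y - X *\<^sub>v \<beta>\<^sub>0)" by (simp add: g_def)
  have "isCont g 0"
  proof -
    have "isCont (\<lambda>t. \<Sum>i<n. (y $ i
        - (\<Sum>k<p. X $$ (i,k) * (\<beta>\<^sub>0 $ k + (if k \<in> T then t else 0))))\<^sup>2) 0"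
    proof (intro continuous_intros)
      show "isCont (\<lambda>t. if k \<in> T then t else 0) 0" for k
        by (cases "k \<in> T") auto
    qed
    thus ?thesis by (simp add: g_eq[abs_def])
  qed
  hence lim: "(g \<longlongrightarrow> sq_l2_norm (y - X *\<^sub>v \<beta>\<^sub>0)) (at 0)"
    by (simp add: isCont_def g0)
  have "\<forall>\<^sub>F t in at 0. \<forall>i\<in>T. \<beta>\<^sub>0 $ i + t \<noteq> 0"
  proof (rule eventually_ball_finite[OF fin], intro ballI)
    fix i assume "i \<in> T"
    show "\<forall>\<^sub>F t in at 0. \<beta>\<^sub>0 $ i + t \<noteq> 0"
      using eventually_neq_at_within[of "- \<beta>\<^sub>0 $ i" 0 UNIV]
      by (rule eventually_mono) auto
  qed
  hence ev: "\<forall>\<^sub>F t in at 0. g t \<in> L"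
  proof (rule eventually_mono)
    fix t assume nz: "\<forall>i\<in>T. \<beta>\<^sub>0 $ i + t \<noteq> 0"
    have "vec_support (\<beta> t) = T"
      using nz T \<beta>\<^sub>0 by (auto simp: vec_support_def \<beta>_def)
    thus "g t \<in> L" by (auto simp: L_def g_def \<beta>_def)
  qed
  have "L \<noteq> {}"
    using eventually_happens[OF ev] by auto
  hence "sq_l2_norm (y - X *\<^sub>v \<beta>\<^sub>0) \<le> Inf L"
    using below by (rule cInf_greatest)
  moreover have "Inf L \<le> sq_l2_norm (y - X *\<^sub>v \<beta>\<^sub>0)"
  proof (rule tendsto_lowerbound[OF lim])
    have "bdd_below L" using below by (auto simp: bdd_below_def)
    thus "\<forall>\<^sub>F t in at 0. Inf L \<le> g t"
      using ev by (auto elim!: eventually_mono intro: cInf_lower)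
  qed simp
  ultimately show ?thesis by (simp add: loss)
qed

section \<open>The loss after adding one column\<close>

lemma sq_l2_norm_orthogonal_expand:
  assumes "r \<in> carrier_vec n" "q \<in> carrier_vec n" "w \<in> carrier_vec n"
    and "r \<bullet> w = 0" "q \<bullet> w = 0"
  shows "sq_l2_norm (r - t \<cdot>\<^sub>v q - w)
       = sq_l2_norm r - 2 * t * (r \<bullet> q) + t\<^sup>2 * (q \<bullet> q) + sq_l2_norm w"
proof -
  have "sq_l2_norm (r - t \<cdot>\<^sub>v q - w) =
      (\<Sum>i<n. r $ i * r $ i - 2 * t * (r $ i * q $ i) + t\<^sup>2 * (q $ i * q $ i) + w $ i * w $ i
        - 2 * (r $ i * w $ i) + 2 * t * (q $ i * w $ i))"
    using assms by (auto simp: sq_l2_norm_def power2_eq_square algebra_simps intro!: sum.cong)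
  also have "\<dots> = r \<bullet> r - 2 * t * (r \<bullet> q) + t\<^sup>2 * (q \<bullet> q) + w \<bullet> w
      - 2 * (r \<bullet> w) + 2 * t * (q \<bullet> w)"
    using assms(1-3)
    by (simp add: scalar_prod_def atLeast0LessThan sum.distrib sum_subtractf sum_distrib_left)
  finally show ?thesis using assms by (simp add: sq_l2_norm_eq_scalar_prod)
qed

text \<open>For \<open>a > 0\<close> this is completing the square, with vertex \<open>t = b / a\<close>.  For \<open>a = 0\<close> both sides
  are \<open>0\<close>, the left one by division by zero.\<close>

lemma quadratic_ge_vertex:
  fixes a b t :: real
  assumes "0 \<le> a" "a = 0 \<Longrightarrow> b = 0"
  shows "- b\<^sup>2 / a \<le> t\<^sup>2 * a - 2 * t * b"
proof (cases "a = 0")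
  case False
  hence "t\<^sup>2 * a - 2 * t * b + b\<^sup>2 / a = a * (t - b / a)\<^sup>2"
    by (simp add: field_simps power2_eq_square)
  moreover have "0 \<le> a * (t - b / a)\<^sup>2" using assms by simp
  ultimately show ?thesis by simp
qed (use assms in simp)

text \<open>The squared residual drops by the squared length of the projection of \<open>r\<close> onto the part
  \<open>q\<close> of the new column that is orthogonal to the old ones.  If that column already lies in the
  span of the old ones, then \<open>q = 0\<close>, nothing is gained, and the quotient is \<open>0 / 0 = 0\<close>.\<close>

lemma support_loss_add_column:
  assumes X: "X \<in> carrier_mat n p" and y: "y \<in> carrier_vec n" and S: "S \<subseteq> {..<p}"
    and ker: "\<And>v. v \<in> carrier_vec (card S) \<Longrightarrow> col_submatrix X S *\<^sub>v v = 0\<^sub>v n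
               \<Longrightarrow> v = 0\<^sub>v (card S)"
    and j: "j \<in> {..<p} - S" and r: "r = y - proj_mat X S *\<^sub>v y"
  shows "support_loss X y (S \<union> {j}) = sq_l2_norm r
    - (r \<bullet> col X j)\<^sup>2 / (col X j \<bullet> ((1\<^sub>m n - proj_mat X S) *\<^sub>v col X j))"
proof -
  define P where "P = proj_mat X S"
  define x where "x = col X j"
  define q where "q = x - P *\<^sub>v x"
  have P: "P \<in> carrier_mat n n" unfolding P_def by (rule proj_mat_carrier[OF X S ker])
  have x: "x \<in> carrier_vec n" using X by (auto simp: x_def)
  have q: "q \<in> carrier_vec n" using x P by (simp add: q_def)
  have rc: "r \<in> carrier_vec n" using y P by (simp add: r flip: P_def)
  obtain a where a: "a \<in> carrier_vec p" "vec_support a \<subseteq> S" "P *\<^sub>v y = X *\<^sub>v a"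
    using proj_mat_in_column_span[OF X S ker y] unfolding P_def by blast
  obtain b where b: "b \<in> carrier_vec p" "vec_support b \<subseteq> S" "P *\<^sub>v x = X *\<^sub>v b"
    using proj_mat_in_column_span[OF X S ker x] unfolding P_def by blast
  have vanish: "a $ i = 0" "b $ i = 0" if "i < p" "i \<notin> S" for i
    using a b that by (auto simp: vec_support_def)
  have r_orth: "r \<bullet> (X *\<^sub>v \<gamma>) = 0" if "\<gamma> \<in> carrier_vec p" "vec_support \<gamma> \<subseteq> S" for \<gamma>
    using proj_mat_residual_orthogonal[OF X S ker y that] by (simp add: r)
  have q_orth: "q \<bullet> (X *\<^sub>v \<gamma>) = 0" if "\<gamma> \<in> carrier_vec p" "vec_support \<gamma> \<subseteq> S" for \<gamma>
    using proj_mat_residual_orthogonal[OF X S ker x that] by (simp add: q_def P_def)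
  have rq: "r \<bullet> q = r \<bullet> x"
    using scalar_prod_minus_distrib[OF rc x, of "P *\<^sub>v x"] r_orth[OF b(1,2)] b X
    by (simp add: q_def)
  have qq: "x \<bullet> ((1\<^sub>m n - P) *\<^sub>v x) = q \<bullet> q"
  proof -
    have "(1\<^sub>m n - P) *\<^sub>v x = q"
      using minus_mult_distrib_mat_vec[OF _ P x, of "1\<^sub>m n"] x by (simp add: q_def)
    moreover have "q \<bullet> q = q \<bullet> x"
      using scalar_prod_minus_distrib[OF q x, of "P *\<^sub>v x"] q_orth[OF b(1,2)] b X
      by (simp add: q_def)
    ultimately show ?thesis using comm_scalar_prod[OF q x] by simp
  qed
  \<comment> \<open>Coordinates adapted to the splitting: \<open>a\<close> contributes \<open>P y\<close>, \<open>unit_vec p j - b\<close> contributes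
    \<open>q\<close>, and \<open>\<gamma>\<close> the remaining component in the span of \<open>S\<close>.\<close>
  have expand: "sq_l2_norm (y - X *\<^sub>v \<beta>)
      = sq_l2_norm r - 2 * t * (r \<bullet> q) + t\<^sup>2 * (q \<bullet> q) + sq_l2_norm (X *\<^sub>v \<gamma>)"
    if \<gamma>: "\<gamma> \<in> carrier_vec p" "vec_support \<gamma> \<subseteq> S"
      and \<beta>: "\<beta> = a + t \<cdot>\<^sub>v (unit_vec p j - b) + \<gamma>" for \<beta> \<gamma> t
  proof -
    have "X *\<^sub>v \<beta> = X *\<^sub>v a + t \<cdot>\<^sub>v (x - X *\<^sub>v b) + X *\<^sub>v \<gamma>"
    proof -
      have e: "X *\<^sub>v unit_vec p j = x"
        using X j by (auto simp: x_def)
      have "X *\<^sub>v \<beta> = X *\<^sub>v (a + t \<cdot>\<^sub>v (unit_vec p j - b)) + X *\<^sub>v \<gamma>"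
        unfolding \<beta> using a b \<gamma> by (intro mult_add_distrib_mat_vec[OF X]) auto
      also have "X *\<^sub>v (a + t \<cdot>\<^sub>v (unit_vec p j - b)) = X *\<^sub>v a + X *\<^sub>v (t \<cdot>\<^sub>v (unit_vec p j - b))"
        using a b by (intro mult_add_distrib_mat_vec[OF X]) auto
      also have "X *\<^sub>v (t \<cdot>\<^sub>v (unit_vec p j - b)) = t \<cdot>\<^sub>v (X *\<^sub>v (unit_vec p j - b))"
        using b by (intro mult_mat_vec[OF X]) auto
      also have "X *\<^sub>v (unit_vec p j - b) = x - X *\<^sub>v b"
        using mult_minus_distrib_mat_vec[OF X _ b(1), of "unit_vec p j"] e by simp
      finally show ?thesis .
    qed
    hence "y - X *\<^sub>v \<beta> = r - t \<cdot>\<^sub>v q - X *\<^sub>v \<gamma>"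
      using X y x a(1) b(1) \<gamma>(1)
      by (intro eq_vecI) (auto simp: r q_def a(3) b(3) simp flip: P_def)
    thus ?thesis
      using sq_l2_norm_orthogonal_expand[OF rc q _ r_orth[OF \<gamma>] q_orth[OF \<gamma>], of t] X \<gamma> by simp
  qed
  have degenerate: "r \<bullet> q = 0" if "q \<bullet> q = 0"
    using sq_l2_norm_eq_0_imp_zero[OF q] that rc by (simp add: sq_l2_norm_eq_scalar_prod)
  \<comment> \<open>The vertex of the parabola in \<open>t\<close>, with \<open>\<gamma> = 0\<close>.\<close>
  define t\<^sub>0 where "t\<^sub>0 = (r \<bullet> q) / (q \<bullet> q)"
  define \<beta>\<^sub>0 where "\<beta>\<^sub>0 = a + t\<^sub>0 \<cdot>\<^sub>v (unit_vec p j - b) + 0\<^sub>v p"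
  have \<beta>\<^sub>0: "\<beta>\<^sub>0 \<in> carrier_vec p" "vec_support \<beta>\<^sub>0 \<subseteq> S \<union> {j}"
    using a b vanish by (auto simp: \<beta>\<^sub>0_def vec_support_def unit_vec_def split: if_splits)
  have attained: "sq_l2_norm (y - X *\<^sub>v \<beta>\<^sub>0) = sq_l2_norm r - (r \<bullet> q)\<^sup>2 / (q \<bullet> q)"
  proof -
    have X0: "X *\<^sub>v 0\<^sub>v p = 0\<^sub>v n" using X by auto
    have "sq_l2_norm (y - X *\<^sub>v \<beta>\<^sub>0)
        = sq_l2_norm r - 2 * t\<^sub>0 * (r \<bullet> q) + t\<^sub>0\<^sup>2 * (q \<bullet> q) + sq_l2_norm (X *\<^sub>v 0\<^sub>v p)"
      by (rule expand[OF _ _ \<beta>\<^sub>0_def]) (auto simp: vec_support_def)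
    thus ?thesis
      by (cases "q \<bullet> q = 0")
        (simp_all add: t\<^sub>0_def X0 sq_l2_norm_def field_simps power2_eq_square)
  qed
  have "support_loss X y (S \<union> {j}) = sq_l2_norm (y - X *\<^sub>v \<beta>\<^sub>0)"
  proof (rule support_loss_eq_minimum[OF X y _ \<beta>\<^sub>0])
    show "S \<union> {j} \<subseteq> {..<p}" using S j by auto
    fix \<beta> :: "real vec" assume \<beta>: "\<beta> \<in> carrier_vec p" "vec_support \<beta> \<subseteq> S \<union> {j}"
    \<comment> \<open>As \<open>a\<close> and \<open>b\<close> vanish at \<open>j\<close>, this choice of \<open>t\<close> removes \<open>j\<close> from the support of \<open>\<gamma>\<close>.\<close>
    define t where "t = \<beta> $ j"
    define \<gamma> where "\<gamma> = \<beta> - a - t \<cdot>\<^sub>v (unit_vec p j - b)"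
    have \<gamma>: "\<gamma> \<in> carrier_vec p" using \<beta> a b by (simp add: \<gamma>_def)
    have "\<gamma> $ i = 0" if i: "i < p" "i \<notin> S" for i
    proof (cases "i = j")
      case False
      hence "\<beta> $ i = 0" using \<beta> i by (auto simp: vec_support_def)
      thus ?thesis using a b i False vanish[OF i] by (simp add: \<gamma>_def unit_vec_def)
    qed (use a b i vanish[OF i] in \<open>simp add: \<gamma>_def t_def\<close>)
    hence "vec_support \<gamma> \<subseteq> S"
      using \<gamma> by (auto simp: vec_support_def)
    moreover have "\<beta> = a + t \<cdot>\<^sub>v (unit_vec p j - b) + \<gamma>"
      using \<beta> a b by (intro eq_vecI) (auto simp: \<gamma>_def)
    ultimately have "sq_l2_norm (y - X *\<^sub>v \<beta>)
        = sq_l2_norm r - 2 * t * (r \<bullet> q) + t\<^sup>2 * (q \<bullet> q) + sq_l2_norm (X *\<^sub>v \<gamma>)"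
      using expand[OF \<gamma>] by blast
    moreover have "- (r \<bullet> q)\<^sup>2 / (q \<bullet> q) \<le> t\<^sup>2 * (q \<bullet> q) - 2 * t * (r \<bullet> q)"
      using sq_l2_norm_nonneg[of q] degenerate
      by (intro quadratic_ge_vertex) (auto simp: sq_l2_norm_eq_scalar_prod)
    ultimately show "sq_l2_norm (y - X *\<^sub>v \<beta>\<^sub>0) \<le> sq_l2_norm (y - X *\<^sub>v \<beta>)"
      using sq_l2_norm_nonneg[of "X *\<^sub>v \<gamma>"] attained by simp
  qed
  thus ?thesis by (simp add: attained rq qq flip: P_def x_def)
qed

theorem theorem4p1:
  fixes n p :: nat and X :: "real mat" and y r :: "real vec"
    and S :: "nat set" and jstar :: nat
  assumes "X \<in> carrier_mat n p"
    and "y \<in> carrier_vec n"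
    and "S \<subset> {..<p}"
    and "\<forall>j \<in> {..<p} - S. full_column_rank (col_submatrix X (S \<union> {j}))"
    and "r = y - proj_mat X S *\<^sub>v y"
    and "is_arg_max
           (\<lambda>j. (r \<bullet> col X j)\<^sup>2 / (col X j \<bullet> ((1\<^sub>m n - proj_mat X S) *\<^sub>v col X j)))
           (\<lambda>j. j \<in> {..<p} - S) jstar"
  shows "\<forall>j \<in> {..<p} - S. support_loss X y (S \<union> {jstar}) \<le> support_loss X y (S \<union> {j})"
proof
  fix j assume j: "j \<in> {..<p} - S"
  have S: "S \<subseteq> {..<p}" using assms(3) by blast
  have ker: "v = 0\<^sub>v (card S)"
    if "v \<in> carrier_vec (card S)" "col_submatrix X S *\<^sub>v v = 0\<^sub>v n" for v
    using full_column_rank_subset_kernel_trivial[OF assms(1) _ _ _ that, of "S \<union> {j}"]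
      assms(4) j S by blast
  have jstar: "jstar \<in> {..<p} - S"
    using assms(6) by (simp add: is_arg_max_def)
  have "(r \<bullet> col X j)\<^sup>2 / (col X j \<bullet> ((1\<^sub>m n - proj_mat X S) *\<^sub>v col X j))
      \<le> (r \<bullet> col X jstar)\<^sup>2 / (col X jstar \<bullet> ((1\<^sub>m n - proj_mat X S) *\<^sub>v col X jstar))"
    using assms(6) j unfolding is_arg_max_linorder by blast
  thus "support_loss X y (S \<union> {jstar}) \<le> support_loss X y (S \<union> {j})"
    using support_loss_add_column[OF assms(1,2) S ker j assms(5)]
      support_loss_add_column[OF assms(1,2) S ker jstar assms(5)] by simp
qed

end
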